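(* For every triple $(u,v,w)\in\{0,1\}^3$ with $(u,v,w)\neq(1,1,1)$, there exists a Cantor metric space of totally exotic type $(u,v,w)$.
   Context: A Cantor metric space is a metric space homeomorphic to the middle-third Cantor set. $B(x,r)$ and $U(x,r)$ denote the closed and open metric balls. Properties of a metric space $(X,d)$: - Doubling ($D$): there is a positive integer $N$ such that every closed ball of radius $r$ can be covered by at most $N$ closed balls of radius $r/2$. - Uniformly disconnected ($UD$): there is $\delta\in(0,1)$ such that every $\delta$-chain is constant, where a $\delta$-chain is a finite sequence $x:\{0,1,\dots,N\}\to X$ with $d(x(i-1),x(i))\le\delta\, d(x(0),x(N))$ for all $i\in\{1,\dots,N\}$. - Uniformly perfect ($UP$): there is $\rho\in(0,1]$ such that for every $x\in X$ and every $r\in(0,\operatorname{diam}(X))$ the set $B(x,r)\setminus U(x,\rho r)$ is non-empty. For a property $P$, $T_P(X,d)=1$ if $(X,d)$ satisfies $P$ and $T_P(X,d)=0$ otherwise. $(X,d)$ has type $(u,v,w)\in\{0,1\}^3$ if $T_D(X,d)=u$, $T_{UD}(X,d)=v$, $T_{UP}(X,d)=w$. The type is exotic if it is not $(1,1,1)$. $S_P(X,d)$ is the set of all points of $X$ none of whose neighborhoods (with the restricted metric) satisfies $P$. $(X,d)$ has totally exotic type $(u,v,w)$ if it has exotic type $(u,v,w)$ and $S_P(X,d)=X$ for all $P\in\{D,UD,UP\}$ with $T_P(X,d)=0$. *)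

theory Defs
  imports "HOL-Analysis.Analysis"
begin

primrec cantor_step :: "nat \<Rightarrow> real set" where
  "cantor_step 0 = {0..1}"
| "cantor_step (Suc n) = (\<lambda>x. x / 3) ` cantor_step n \<union> (\<lambda>x. (x + 2) / 3) ` cantor_step n"

definition cantor_set :: "real set" where
  "cantor_set = (\<Inter>n. cantor_step n)"

definition cantor_metric_space :: "'a metric \<Rightarrow> bool" where
  "cantor_metric_space X \<longleftrightarrow> mtopology_of X homeomorphic_space top_of_set cantor_set"

definition doubling :: "'a metric \<Rightarrow> bool" where
  "doubling X \<longleftrightarrow>
     (\<exists>N::nat. N > 0 \<and>
        (\<forall>x\<in>mspace X. \<forall>r>0. \<exists>C. C \<subseteq> mspace X \<and> finite C \<and> card C \<le> N \<and>
           mcball_of X x r \<subseteq> (\<Union>c\<in>C. mcball_of X c (r / 2))))"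

definition delta_chain :: "'a metric \<Rightarrow> real \<Rightarrow> nat \<Rightarrow> (nat \<Rightarrow> 'a) \<Rightarrow> bool" where
  "delta_chain X \<delta> N x \<longleftrightarrow>
     x ` {0..N} \<subseteq> mspace X \<and>
     (\<forall>i\<in>{1..N}. mdist X (x (i - 1)) (x i) \<le> \<delta> * mdist X (x 0) (x N))"

definition uniformly_disconnected :: "'a metric \<Rightarrow> bool" where
  "uniformly_disconnected X \<longleftrightarrow>
     (\<exists>\<delta>. 0 < \<delta> \<and> \<delta> < 1 \<and>
        (\<forall>N x. delta_chain X \<delta> N x \<longrightarrow> (\<forall>i\<in>{0..N}. \<forall>j\<in>{0..N}. x i = x j)))"

(* Extended-real valued, so that unbounded spaces have diameter infinity. *)
definition mdiam :: "'a metric \<Rightarrow> ereal" where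
  "mdiam X = (SUP (x, y) \<in> mspace X \<times> mspace X. ereal (mdist X x y))"

definition uniformly_perfect :: "'a metric \<Rightarrow> bool" where
  "uniformly_perfect X \<longleftrightarrow>
     (\<exists>\<rho>. 0 < \<rho> \<and> \<rho> \<le> 1 \<and>
        (\<forall>x\<in>mspace X. \<forall>r. 0 < r \<and> ereal r < mdiam X \<longrightarrow>
           mcball_of X x r - mball_of X x (\<rho> * r) \<noteq> {}))"

definition T :: "('a metric \<Rightarrow> bool) \<Rightarrow> 'a metric \<Rightarrow> nat" where
  "T P X = (if P X then 1 else 0)"

definition has_type :: "'a metric \<Rightarrow> nat \<times> nat \<times> nat \<Rightarrow> bool" where
  "has_type X = (\<lambda>(u, v, w).
     T doubling X = u \<and> T uniformly_disconnected X = v \<and> T uniformly_perfect X = w)"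

(* Neighbourhoods need not be open. *)
definition neighbourhood :: "'a metric \<Rightarrow> 'a \<Rightarrow> 'a set \<Rightarrow> bool" where
  "neighbourhood X x A \<longleftrightarrow>
     A \<subseteq> mspace X \<and> (\<exists>U. openin (mtopology_of X) U \<and> x \<in> U \<and> U \<subseteq> A)"

definition S :: "('a metric \<Rightarrow> bool) \<Rightarrow> 'a metric \<Rightarrow> 'a set" where
  "S P X = {x \<in> mspace X. \<forall>A. neighbourhood X x A \<longrightarrow> \<not> P (submetric X A)}"

definition exotic :: "nat \<times> nat \<times> nat \<Rightarrow> bool" where
  "exotic t \<longleftrightarrow> t \<in> {0, 1} \<times> {0, 1} \<times> {0, 1} \<and> t \<noteq> (1, 1, 1)"

definition totally_exotic_type :: "'a metric \<Rightarrow> nat \<times> nat \<times> nat \<Rightarrow> bool" where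
  "totally_exotic_type X t \<longleftrightarrow>
     exotic t \<and> has_type X t \<and>
     (\<forall>P \<in> {doubling, uniformly_disconnected, uniformly_perfect}. T P X = 0 \<longrightarrow> S P X = mspace X)"

end

(* Give every point of the Cantor set a sequence of digits D 0, D 1, ... with D n in {0..K n}, and
   let two points that first differ in digit n have distance a n * min |i - j| (c n), where i and j
   are their n-th digits. If 4 * a (n + 1) * c (n + 1) <= a n, this metric induces the usual topology.
   The three properties are then controlled separately: c = 1 gives an ultrametric and hence UD,
   while long arithmetic progressions of digits (c unbounded) are fine chains in every ball;
   c = K gives a space that is bi-Lipschitz to a subset of the line and hence D, while c n = 1 with
   K n large puts many equidistant points in every ball; and UP holds or fails according to
   whether a (n + 1) * c (n + 1) / a n is constant or tends to 0. *)

theory Submission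
  imports Defs
begin

section \<open>Metrics defined by the first differing digit\<close>

text \<open>The nonzero distances created at level \<open>n\<close> range from \<open>a n\<close> to
  at most \<open>a n * c n\<close>. By \<open>a_Suc\<close>, the largest at level
  \<open>Suc n\<close> is at most a quarter of the smallest at level \<open>n\<close>, so the levels
  stay separated. \<open>digit_ext\<close> prescribes one digit and leaves later digits free, so
  \<open>M\<close> may omit some digit sequences.\<close>

locale digit_space =
  fixes M :: "'a set" and D :: "nat \<Rightarrow> 'a \<Rightarrow> nat"
    and K c :: "nat \<Rightarrow> nat" and a :: "nat \<Rightarrow> real"
  assumes M_nonempty: "M \<noteq> {}"
    and digit_le: "p \<in> M \<Longrightarrow> D n p \<le> K n"
    and digit_ext: "p \<in> M \<Longrightarrow> j \<le> K n \<Longrightarrow> \<exists>q\<in>M. (\<forall>m<n. D m p = D m q) \<and> D n q = j"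
    and digits_inject: "p \<in> M \<Longrightarrow> q \<in> M \<Longrightarrow> (\<And>n. D n p = D n q) \<Longrightarrow> p = q"
    and c_ge_1: "1 \<le> c n"
    and c_le_K: "c n \<le> K n"
    and a_pos: "0 < a n"
    and a_Suc: "4 * (a (Suc n) * c (Suc n)) \<le> a n"
begin

definition agree :: "nat \<Rightarrow> 'a \<Rightarrow> 'a \<Rightarrow> bool" where
  "agree n p q \<longleftrightarrow> (\<forall>m<n. D m p = D m q)"

definition digit_dist :: "'a \<Rightarrow> 'a \<Rightarrow> real" where
  "digit_dist p q =
     (if \<forall>n. D n p = D n q then 0
      else let n = LEAST n. D n p \<noteq> D n q in a n * min \<bar>real (D n p) - real (D n q)\<bar> (c n))"

lemma agree_refl [simp]: "agree n p p"
  by (simp add: agree_def)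

lemma agree_sym: "agree n p q \<Longrightarrow> agree n q p"
  by (simp add: agree_def)

lemma agree_trans: "agree n p q \<Longrightarrow> agree n q r \<Longrightarrow> agree n p r"
  by (simp add: agree_def)

lemma agree_mono: "agree n p q \<Longrightarrow> m \<le> n \<Longrightarrow> agree m p q"
  by (simp add: agree_def)

lemma agree_Suc: "agree (Suc n) p q \<longleftrightarrow> agree n p q \<and> D n p = D n q"
  by (auto simp: agree_def less_Suc_eq)

lemma first_diff:
  assumes "\<not> agree n p q"
  obtains m where "m < n" "agree m p q" "D m p \<noteq> D m q"
proof -
  obtain k where k: "k < n" "D k p \<noteq> D k q"
    using assms by (auto simp: agree_def)
  define m where "m = (LEAST m. D m p \<noteq> D m q)"
  have "D m p \<noteq> D m q" "m \<le> k"
    unfolding m_def using k(2) by (rule LeastI, rule Least_le)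
  moreover have "agree m p q"
    unfolding agree_def m_def using not_less_Least by blast
  ultimately show thesis using that k(1) le_less_trans by blast
qed

lemma neq_first_diff:
  assumes "p \<in> M" "q \<in> M" "p \<noteq> q"
  obtains m where "agree m p q" "D m p \<noteq> D m q"
proof -
  obtain n where "D n p \<noteq> D n q" using digits_inject assms by blast
  then have "\<not> agree (Suc n) p q" by (simp add: agree_Suc)
  then show thesis using first_diff that by metis
qed

lemma digit_dist_first_diff:
  assumes "agree n p q" "D n p \<noteq> D n q"
  shows "digit_dist p q = a n * min \<bar>real (D n p) - real (D n q)\<bar> (c n)"
proof -
  have "(LEAST n. D n p \<noteq> D n q) = n"
    using assms by (intro Least_equality) (auto simp: agree_def not_less[symmetric])
  then show ?thesis using assms(2) by (auto simp: digit_dist_def Let_def)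
qed

lemma digit_dist_self [simp]: "digit_dist p p = 0"
  by (simp add: digit_dist_def)

lemma digit_dist_commute: "digit_dist p q = digit_dist q p"
proof -
  have "(D n p \<noteq> D n q) = (D n q \<noteq> D n p)" for n by auto
  then show ?thesis by (simp add: digit_dist_def Let_def abs_minus_commute eq_commute)
qed

lemma digit_dist_nonneg: "0 \<le> digit_dist p q"
  using a_pos by (auto simp: digit_dist_def Let_def less_imp_le)

lemma a_le: "a (Suc n) \<le> a n / 4"
proof -
  have "a (Suc n) * 1 \<le> a (Suc n) * c (Suc n)"
    using c_ge_1[of "Suc n"] a_pos[of "Suc n"] by (intro mult_left_mono) auto
  then show ?thesis using a_Suc[of n] by simp
qed

lemma a_add_le: "a (n + k) \<le> a n / 4 ^ k"
proof (induction k)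
  case (Suc k)
  have "a (n + Suc k) \<le> a (n + k) / 4" using a_le[of "n + k"] by simp
  also have "\<dots> \<le> (a n / 4 ^ k) / 4" using Suc by (intro divide_right_mono) auto
  finally show ?case by (simp add: field_simps)
qed simp

lemma a_antimono: "m \<le> n \<Longrightarrow> a n \<le> a m"
proof (rule lift_Suc_antimono_le[of a])
  show "a (Suc n) \<le> a n" for n using a_le[of n] a_pos[of n] by linarith
qed

text \<open>Distinct digits differ by at least 1 and \<open>1 \<le> c m\<close>, so a first
  difference at \<open>m \<le> n\<close> costs at least \<open>a m \<ge> a n\<close>. With
  \<open>digit_dist_le\<close> this makes balls and cylinders comparable.\<close>

lemma digit_dist_ge:
  assumes "\<not> agree (Suc n) p q"
  shows "a n \<le> digit_dist p q"
proof -
  obtain m where m: "m < Suc n" "agree m p q" "D m p \<noteq> D m q"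
    using assms by (rule first_diff)
  have "a n \<le> a m * 1" using a_antimono m by simp
  also have "\<dots> \<le> a m * min \<bar>real (D m p) - real (D m q)\<bar> (c m)"
    using m(3) c_ge_1[of m] a_pos[of m] by (intro mult_left_mono) auto
  finally show ?thesis using digit_dist_first_diff m by simp
qed

lemma agree_if_dist_less: "digit_dist p q < a n \<Longrightarrow> agree (Suc n) p q"
  using digit_dist_ge by fastforce

lemma a_c_antimono: "m \<le> n \<Longrightarrow> a n * c n \<le> a m * c m"
proof (rule lift_Suc_antimono_le[of "\<lambda>n. a n * c n"])
  fix n
  have "a n * 1 \<le> a n * c n"
    using c_ge_1[of n] a_pos[of n] by (intro mult_left_mono) auto
  moreover have "0 \<le> a (Suc n) * c (Suc n)" using a_pos[of "Suc n"] by simp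
  ultimately show "a (Suc n) * c (Suc n) \<le> a n * c n" using a_Suc[of n] by simp
qed

lemma digit_dist_le:
  assumes "agree n p q"
  shows "digit_dist p q \<le> a n * c n"
proof (cases "\<forall>k. D k p = D k q")
  case True
  then show ?thesis using a_pos[of n] by (simp add: digit_dist_def)
next
  case False
  then obtain k where "\<not> agree (Suc k) p q" by (auto simp: agree_Suc)
  then obtain m where m: "agree m p q" "D m p \<noteq> D m q"
    by (rule first_diff)
  have "n \<le> m" using m(2) assms by (auto simp: agree_def not_less[symmetric])
  have "digit_dist p q \<le> a m * c m"
    using digit_dist_first_diff[OF m] a_pos[of m] by simp
  also have "\<dots> \<le> a n * c n" by (rule a_c_antimono[OF \<open>n \<le> m\<close>])
  finally show ?thesis .
qed

text \<open>Let \<open>n\<close> be the first level where \<open>p\<close> and \<open>r\<close>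
  differ. If \<open>q\<close> still agrees with \<open>p\<close> below \<open>n\<close>, the
  truncated absolute value at level \<open>n\<close> is itself a metric on digits. If
  \<open>q\<close> branches off earlier, level separation makes \<open>digit_dist p q\<close> alone
  large enough.\<close>

lemma digit_dist_triangle:
  assumes "p \<in> M" "q \<in> M" "r \<in> M"
  shows "digit_dist p r \<le> digit_dist p q + digit_dist q r"
proof (cases "p = r")
  case True
  then show ?thesis using digit_dist_nonneg by simp
next
  case False
  then obtain n where n: "agree n p r" "D n p \<noteq> D n r"
    using assms neq_first_diff by metis
  have pr: "digit_dist p r = a n * min \<bar>real (D n p) - real (D n r)\<bar> (c n)"
    by (rule digit_dist_first_diff[OF n])
  show ?thesis
  proof (cases "agree n p q")
    case True
    then have qr: "agree n q r" using n agree_sym agree_trans by blast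
    define e where "e i j = a n * min \<bar>real i - real j\<bar> (c n)" for i j
    \<comment> \<open>Only an inequality: points with equal digits at level \<open>n\<close> may
      still differ later.\<close>
    have le: "e (D n x) (D n y) \<le> digit_dist x y" if "agree n x y" for x y
      using digit_dist_first_diff[OF that] digit_dist_nonneg[of x y]
      by (cases "D n x = D n y") (auto simp: e_def)
    have "e i k \<le> e i j + e j k" for i j k
    proof -
      have "(min \<bar>real i - real k\<bar> (c n)) \<le> (min \<bar>real i - real j\<bar> (c n)) + (min \<bar>real j - real k\<bar> (c n))"
        by linarith
      then have "e i k \<le> a n * (min \<bar>real i - real j\<bar> (c n) + min \<bar>real j - real k\<bar> (c n))"
        unfolding e_def using a_pos[of n] by (intro mult_left_mono) auto
      then show ?thesis by (simp add: e_def distrib_left)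
    qed
    then have "digit_dist p r \<le> e (D n p) (D n q) + e (D n q) (D n r)"
      unfolding pr e_def[symmetric] .
    then show ?thesis using le[OF True] le[OF qr] by linarith
  next
    case False
    then obtain m where m: "m < n" "agree m p q" "D m p \<noteq> D m q"
      by (rule first_diff)
    have "digit_dist p r \<le> a n * c n" by (rule digit_dist_le[OF n(1)])
    also have "\<dots> \<le> a (Suc m) * c (Suc m)" using m by (intro a_c_antimono) simp
    also have "\<dots> \<le> a m" using a_Suc[of m] a_pos[of m] by linarith
    also have "\<dots> \<le> digit_dist p q" using m(3) by (intro digit_dist_ge) (simp add: agree_Suc)
    finally show ?thesis using digit_dist_nonneg[of q r] by linarith
  qed
qed

sublocale Metric_space M digit_dist
proof
  fix x y assume "x \<in> M" "y \<in> M"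
  then show "digit_dist x y = 0 \<longleftrightarrow> x = y"
    by (metis a_pos agree_Suc digit_dist_ge digit_dist_self neq_first_diff not_less)
qed (use digit_dist_nonneg digit_dist_commute digit_dist_triangle in auto)

definition X :: "'a metric" where "X = metric (M, digit_dist)"

lemma mspace_X [simp]: "mspace X = M" and mdist_X [simp]: "mdist X = digit_dist"
  and mtopology_X: "mtopology_of X = mtopology"
  by (simp_all add: X_def)

section \<open>The topology of the digit metrics\<close>

text \<open>Decay of \<open>a\<close> alone is not enough, since \<open>c\<close> may be unbounded;
  \<open>a_Suc\<close> bounds the product at level \<open>Suc n\<close> by \<open>a n / 4\<close>,
  which decays geometrically.\<close>

lemma a_c_small:
  assumes "0 < r"
  obtains n where "a n * c n < r"
proof -
  have "(\<lambda>n. a 0 / 4 * (1 / 4) ^ n) \<longlonglongrightarrow> a 0 / 4 * 0"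
    by (intro tendsto_intros LIMSEQ_power_zero) simp
  then have "\<forall>\<^sub>F n in sequentially. a 0 / 4 * (1 / 4) ^ n < r"
    using assms by (intro order_tendstoD) auto
  then obtain n where "a 0 / 4 * (1 / 4) ^ n < r"
    by (auto simp: eventually_sequentially)
  then have "a (Suc n) * c (Suc n) < r"
    using a_Suc[of n] a_add_le[of 0 n] by (simp add: power_one_over)
  then show thesis by (rule that)
qed

text \<open>Cylinders have arbitrarily small diameter, and the one of level \<open>n\<close> around
  \<open>x\<close> contains the ball of radius \<open>a n\<close>. The topology is therefore
  independent of \<open>a\<close> and \<open>c\<close>, so one comparison with the Cantor set serves
  all the metrics.\<close>

lemma openin_X:
  "openin (mtopology_of X) U \<longleftrightarrow> U \<subseteq> M \<and> (\<forall>x\<in>U. \<exists>n. \<forall>y\<in>M. agree n x y \<longrightarrow> y \<in> U)"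
proof -
  have "(\<exists>r>0. mball x r \<subseteq> U) \<longleftrightarrow> (\<exists>n. \<forall>y\<in>M. agree n x y \<longrightarrow> y \<in> U)" if "x \<in> M" for x
  proof
    assume "\<exists>r>0. mball x r \<subseteq> U"
    then obtain r where r: "r > 0" "mball x r \<subseteq> U" by blast
    obtain n where "a n * c n < r" using a_c_small[OF r(1)] .
    then show "\<exists>n. \<forall>y\<in>M. agree n x y \<longrightarrow> y \<in> U"
      using r(2) that digit_dist_le by (intro exI[of _ n]) fastforce
  next
    assume "\<exists>n. \<forall>y\<in>M. agree n x y \<longrightarrow> y \<in> U"
    then obtain n where n: "\<And>y. y \<in> M \<Longrightarrow> agree n x y \<Longrightarrow> y \<in> U" by blast
    have "mball x (a n) \<subseteq> U"
      using n agree_if_dist_less agree_mono by (metis in_mball le_add2 plus_1_eq_Suc subsetI)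
    then show "\<exists>r>0. mball x r \<subseteq> U" using a_pos by blast
  qed
  then show ?thesis by (auto simp: mtopology_X openin_mtopology subset_iff)
qed

lemma neighbourhood_X:
  assumes "neighbourhood X x A" "x \<in> M"
  obtains n where "\<And>y. y \<in> M \<Longrightarrow> agree n x y \<Longrightarrow> y \<in> A" "x \<in> A" "A \<subseteq> M"
  using assms unfolding neighbourhood_def openin_X by (metis mspace_X subsetD)

text \<open>Source of the test points for the failure results: equidistant when
  \<open>c n = 1\<close>, a fine chain when \<open>c n\<close> is large.\<close>

lemma digit_fan:
  assumes "x \<in> M"
  obtains y where "\<And>j. j \<le> K n \<Longrightarrow> y j \<in> M \<and> agree n x (y j) \<and> D n (y j) = j"
proof -
  have "\<exists>y. \<forall>j\<le>K n. y j \<in> M \<and> agree n x (y j) \<and> D n (y j) = j"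
    using digit_ext[OF assms] unfolding agree_def by (intro choice) blast
  then show thesis using that by blast
qed

lemma K_pos: "0 < K n"
  using c_ge_1[of n] c_le_K[of n] by linarith

section \<open>Sufficient conditions for the three properties\<close>

text \<open>If the ends of a chain first differ at level \<open>n\<close>, they are at most
  \<open>a n\<close> apart, so each step is shorter than \<open>a n\<close> and changes no digit up
  to level \<open>n\<close>. Hence the ends coincide, and then every step has length 0.\<close>

lemma uniformly_disconnected_X:
  assumes "\<And>n. c n = 1"
  shows "uniformly_disconnected X"
  unfolding uniformly_disconnected_def
proof (intro exI[of _ "1/2"] conjI allI impI ballI)
  fix N x i j
  assume "delta_chain X (1 / 2) N x" and ij: "i \<in> {0..N}" "j \<in> {0..N}"
  then have M: "\<And>i. i \<le> N \<Longrightarrow> x i \<in> M"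
    and step0: "\<And>i. i \<in> {1..N} \<Longrightarrow> digit_dist (x (i - 1)) (x i) \<le> digit_dist (x 0) (x N) / 2"
    by (auto simp: delta_chain_def)
  have step: "digit_dist (x i) (x (Suc i)) \<le> digit_dist (x 0) (x N) / 2" if "i < N" for i
    using step0[of "Suc i"] that by simp
  have "x 0 = x N"
  proof (rule ccontr)
    assume "x 0 \<noteq> x N"
    then obtain n where n: "agree n (x 0) (x N)" "D n (x 0) \<noteq> D n (x N)"
      using M neq_first_diff by (metis le0 order_refl)
    have "digit_dist (x 0) (x N) \<le> a n" using digit_dist_le[OF n(1)] assms by simp
    then have "digit_dist (x i) (x (Suc i)) < a n" if "i < N" for i
      using step[OF that] a_pos[of n] by linarith
    then have "agree (Suc n) (x 0) (x i)" if "i \<le> N" for i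
      using that
    proof (induction i)
      case (Suc i)
      then show ?case using agree_if_dist_less agree_trans by (meson Suc_le_lessD Suc_leD)
    qed simp
    then show False using n(2) by (auto simp: agree_Suc)
  qed
  then have "x i = x (Suc i)" if "i < N" for i
    using step[OF that] M that digit_dist_nonneg
    by (metis Suc_leI digit_dist_self div_0 less_imp_le mdist_pos_eq not_less)
  then have "x 0 = x i" if "i \<le> N" for i
    using that by (induction i) auto
  then show "x i = x j" using ij by (metis atLeastAtMost_iff)
qed simp_all

text \<open>Level \<open>n\<close> offers the distances \<open>a n\<close>, \<open>2 * a n\<close>,
  up to a fixed fraction of \<open>a n * c n\<close>, and the hypothesis leaves only a bounded ratio
  between consecutive levels. So every radius is matched up to a constant.\<close>

lemma uniformly_perfect_X:
  assumes "\<And>n. a n \<le> 4 * (a (Suc n) * c (Suc n))"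
  shows "uniformly_perfect X"
  unfolding uniformly_perfect_def
\<comment> \<open>A factor 4 is lost when \<open>r / a n\<close> is replaced by the integer
  \<open>m\<close>, and a factor 2 when \<open>m\<close> is halved to \<open>h\<close>.\<close>
proof (intro exI[of _ "1/8"] conjI ballI allI impI)
  fix x r
  assume x: "x \<in> mspace X" and r: "0 < r \<and> ereal r < mdiam X"
  obtain p q where pq: "p \<in> M" "q \<in> M" "r < digit_dist p q"
    using r by (auto simp: mdiam_def less_SUP_iff)
  \<comment> \<open>The bound by the diameter covers the case \<open>n = 0\<close>, where no coarser
    level limits \<open>r\<close>.\<close>
  have r0: "r < a 0 * c 0"
    using digit_dist_le[of 0 p q] pq(3) by (simp add: agree_def)
  define n where "n = (LEAST n. a n \<le> r)"
  have "\<exists>n. a n \<le> r"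
  proof -
    obtain n where "a n * c n < r" using a_c_small r by blast
    moreover have "a n * 1 \<le> a n * c n"
      using c_ge_1[of n] a_pos[of n] by (intro mult_left_mono) auto
    ultimately show ?thesis by (intro exI[of _ n]) simp
  qed
  then have n: "a n \<le> r" unfolding n_def by (rule LeastI_ex)
  have upper: "r < 4 * (a n * c n)"
  proof (cases n)
    case 0
    then show ?thesis using r0 r by simp
  next
    case (Suc k)
    then have "r < a k" unfolding n_def by (metis lessI not_less not_less_Least)
    then show ?thesis using assms[of k] Suc by simp
  qed
  define t where "t = r / a n"
  have t: "1 \<le> t" "t < 4 * c n" using n upper a_pos[of n] by (auto simp: t_def field_simps)
  define m where "m = min (nat \<lfloor>t\<rfloor>) (c n)"
  have fl: "real (nat \<lfloor>t\<rfloor>) \<le> t" "t < real (nat \<lfloor>t\<rfloor>) + 1" "1 \<le> nat \<lfloor>t\<rfloor>"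
    using t(1) by linarith+
  \<comment> \<open>If \<open>m\<close> is the integer part of \<open>t\<close>, then
    \<open>t < m + 1 \<le> 2 * m\<close>; if \<open>m\<close> is capped at \<open>c n\<close>, then
    \<open>t < 4 * c n\<close> applies.\<close>
  have m1: "1 \<le> m" "real m \<le> t" "t \<le> 4 * real m"
    using fl t c_ge_1[of n] unfolding m_def by linarith+
  text \<open>Rounding half of \<^term>\<open>m\<close> up leaves room for this step on at least one side
    of the digit of \<^term>\<open>x\<close>.\<close>
  define h where "h = (m + 1) div 2"
  have h: "1 \<le> h" "h \<le> m" "m \<le> 2 * h" "2 * h \<le> m + 1" using m1(1) by (auto simp: h_def)
  have mK: "m \<le> c n" "m \<le> K n" using c_le_K[of n] by (auto simp: m_def)
  have "\<exists>j\<le>K n. \<bar>real (D n x) - real j\<bar> = h"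
  proof (cases "D n x + h \<le> K n")
    case True
    then show ?thesis by (intro exI[of _ "D n x + h"]) simp
  next
    case False
    then have "h \<le> D n x" "D n x \<le> K n" using h mK digit_le[of x n] x by auto
    then show ?thesis by (intro exI[of _ "D n x - h"]) (auto simp: of_nat_diff)
  qed
  then obtain j where j: "j \<le> K n" "\<bar>real (D n x) - real j\<bar> = h" by blast
  obtain y where y: "y \<in> M" "agree n x y" "D n y = j"
    using digit_ext[of x j n] x j(1) by (auto simp: agree_def)
  have "digit_dist x y = a n * min (real h) (c n)"
    using digit_dist_first_diff[OF y(2)] j(2) h(1) y(3) by auto
  then have d: "digit_dist x y = a n * h" using h mK by simp
  have "a n * h \<le> a n * t" using h m1 a_pos[of n] by (intro mult_left_mono) auto
  moreover have "a n * t \<le> a n * (8 * h)" using h m1 a_pos[of n] by (intro mult_left_mono) auto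
  moreover have "a n * t = r" using a_pos[of n] by (simp add: t_def)
  ultimately have "digit_dist x y \<le> r" "r \<le> 8 * digit_dist x y" using d by auto
  then have "y \<in> mcball_of X x r - mball_of X x (1 / 8 * r)" using x y by simp
  then show "mcball_of X x r - mball_of X x (1 / 8 * r) \<noteq> {}" by blast
qed simp_all

text \<open>If no distance is truncated, \<open>\<Sum>n. a n * D n p\<close> is a bi-Lipschitz map to the real line.\<close>

lemma bilipschitz_real:
  assumes "\<And>n. c n = K n"
  obtains g where "\<And>p q. p \<in> M \<Longrightarrow> q \<in> M \<Longrightarrow>
    2 * digit_dist p q \<le> 3 * \<bar>g p - g q\<bar> \<and> 3 * \<bar>g p - g q\<bar> \<le> 4 * digit_dist p q"
proof
  define g where "g p = (\<Sum>n. a n * D n p)" for p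
  have aK: "a (Suc n) * K (Suc n) \<le> a n / 4" for n using a_Suc[of n] assms by simp
  fix p q assume pq: "p \<in> M" "q \<in> M"
  have tail: "a (n + Suc k) * real (D (n + Suc k) x) \<le> a n / 4 * (1 / 4) ^ k" if "x \<in> M" for n k x
  proof -
    have "a (n + Suc k) * D (n + Suc k) x \<le> a (n + Suc k) * K (n + Suc k)"
      using digit_le[OF that] a_pos[of "n + Suc k"] by (intro mult_left_mono) auto
    also have "\<dots> \<le> a (n + k) / 4" using aK[of "n + k"] by simp
    also have "\<dots> \<le> a n / 4 * (1 / 4) ^ k"
      using a_add_le[of n k] by (simp add: power_one_over field_simps)
    finally show ?thesis .
  qed
  have summ: "summable (\<lambda>n. a n * D n x)" if "x \<in> M" for x
  proof -
    \<comment> \<open>The term of index 0 is split off because \<open>tail\<close> bounds only the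
      levels after \<open>n\<close>.\<close>
    have "summable (\<lambda>k. a (0 + Suc k) * D (0 + Suc k) x)"
    proof (rule summable_comparison_test')
      show "summable (\<lambda>k. a 0 / 4 * (1 / 4) ^ k :: real)"
        by (intro summable_mult summable_geometric) simp
      show "norm (a (0 + Suc k) * D (0 + Suc k) x) \<le> a 0 / 4 * (1 / 4) ^ k" for k
        using tail[OF that, of 0 k] a_pos[of "Suc k"] by simp
    qed
    then show ?thesis using summable_Suc_iff[of "\<lambda>n. a n * D n x"] by simp
  qed
  show "2 * digit_dist p q \<le> 3 * \<bar>g p - g q\<bar> \<and> 3 * \<bar>g p - g q\<bar> \<le> 4 * digit_dist p q"
  proof (cases "p = q")
    case False
    then obtain n where n: "agree n p q" "D n p \<noteq> D n q"
      using neq_first_diff pq by metis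
    define u where "u m = a m * D m p - a m * D m q" for m
    have su: "summable u" unfolding u_def using summ pq by (intro summable_diff)
    have gu: "g p - g q = suminf u"
      unfolding g_def u_def using summ pq by (intro suminf_diff)
    have "suminf u = (\<Sum>k. u (k + Suc n)) + sum u {..<Suc n}"
      by (rule suminf_split_initial_segment[OF su])
    also have "sum u {..<Suc n} = u n"
      using n(1) by (auto simp: u_def agree_def)
    finally have split: "g p - g q = (\<Sum>k. u (k + Suc n)) + u n" using gu by simp
    \<comment> \<open>Both products are nonnegative and obey the bound from \<open>tail\<close>, so
      their difference obeys it without a factor 2.\<close>
    have bound: "norm (u (k + Suc n)) \<le> a n / 4 * (1 / 4) ^ k" for k
    proof -
      have "0 \<le> a (n + Suc k) * D (n + Suc k) x" for x
        using a_pos[of "n + Suc k"] by simp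
      from this[of p] this[of q] tail[OF pq(1), of n k] tail[OF pq(2), of n k] show ?thesis
        unfolding u_def real_norm_def add_Suc add_Suc_right add.commute[of k n] by linarith
    qed
    \<comment> \<open>The geometric series sums to \<open>a n / 3\<close>, at most a third of the
      leading term \<open>\<bar>u n\<bar>\<close>. This gives the constants 2/3 and 4/3.\<close>
    have "norm (\<Sum>k. u (k + Suc n)) \<le> (\<Sum>k. a n / 4 * (1 / 4) ^ k)"
      using bound by (intro norm_suminf_le summable_mult summable_geometric) simp_all
    also have "\<dots> = a n / 3"
      by (subst suminf_mult) (simp_all add: suminf_geometric summable_geometric)
    finally have rest: "\<bar>\<Sum>k. u (k + Suc n)\<bar> \<le> a n / 3" by simp
    have "\<bar>real (D n p) - real (D n q)\<bar> \<le> c n"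
      using digit_le[OF pq(1), of n] digit_le[OF pq(2), of n] assms[of n] by linarith
    then have "digit_dist p q = a n * \<bar>real (D n p) - real (D n q)\<bar>"
      using digit_dist_first_diff[OF n] by simp
    also have "\<dots> = \<bar>u n\<bar>" using a_pos[of n] by (simp add: u_def flip: abs_mult right_diff_distrib) (simp add: abs_mult)
    finally have un: "digit_dist p q = \<bar>u n\<bar>" .
    have "a n \<le> digit_dist p q" using n by (intro digit_dist_ge) (simp add: agree_Suc)
    then have "\<bar>\<Sum>k. u (k + Suc n)\<bar> \<le> \<bar>u n\<bar> / 3" using rest un by linarith
    moreover have "2 * \<bar>y\<bar> \<le> 3 * \<bar>x + y\<bar> \<and> 3 * \<bar>x + y\<bar> \<le> 4 * \<bar>y\<bar>" if "\<bar>x\<bar> \<le> \<bar>y\<bar> / 3" for x y :: real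
      using that by (simp add: abs_if split: if_splits)
    ultimately show ?thesis unfolding un split by blast
  qed simp
qed

text \<open>The line is cut into cells of length \<open>r / 3\<close>. The image of a ball of radius
  \<open>r\<close> meets at most 9 of them, and two points in one cell are within
  \<open>r / 2\<close> of each other. One point of the ball per nonempty cell serves as a
  centre.\<close>

lemma doubling_X:
  assumes "\<And>n. c n = K n"
  shows "doubling X"
proof -
  obtain g where g: "\<And>p q. p \<in> M \<Longrightarrow> q \<in> M \<Longrightarrow>
      2 * digit_dist p q \<le> 3 * \<bar>g p - g q\<bar> \<and> 3 * \<bar>g p - g q\<bar> \<le> 4 * digit_dist p q"
    using bilipschitz_real assms by metis
  show ?thesis
    unfolding doubling_def
  proof (intro exI[of _ 9] conjI ballI allI impI)
    fix x r assume x: "x \<in> mspace X" and r: "0 < (r::real)"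
    define ix where "ix y = \<lfloor>(g y - g x) * 3 / r\<rfloor>" for y
    define B where "B = mcball_of X x r"
    define C where "C = inv_into B ix ` (ix ` B)"
    have ix: "ix ` B \<subseteq> {-4..4}"
    proof
      fix i assume "i \<in> ix ` B"
      then obtain y where y: "y \<in> M" "digit_dist x y \<le> r" "i = ix y" by (auto simp: B_def)
      have "3 * \<bar>g y - g x\<bar> \<le> 4 * r" using g[of y x] y x digit_dist_commute[of x y] by simp
      then have "\<bar>(g y - g x) * 3 / r\<bar> \<le> 4" using r by (auto simp: abs_le_iff abs_if field_simps split: if_splits)
      then show "i \<in> {-4..4}"
        unfolding y(3) ix_def atLeastAtMost_iff by linarith
    qed
    then have fin: "finite (ix ` B)" by (rule finite_subset) simp
    have "card C \<le> card (ix ` B)" unfolding C_def by (rule card_image_le[OF fin])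
    also have "\<dots> \<le> card {-4..4::int}" by (rule card_mono[OF _ ix]) simp
    finally have "card C \<le> 9" by simp
    moreover have "C \<subseteq> B" by (auto simp: C_def intro: inv_into_into)
    moreover have "B \<subseteq> (\<Union>z\<in>C. mcball_of X z (r / 2))"
    proof
      fix y assume y: "y \<in> B"
      define z where "z = inv_into B ix (ix y)"
      have z: "z \<in> C" "z \<in> B" "ix z = ix y"
        using y inv_into_into[of "ix y" ix B] f_inv_into_f[of "ix y" ix B] by (auto simp: C_def z_def)
      have "\<bar>(g y - g x) * 3 / r - (g z - g x) * 3 / r\<bar> < 1"
        using z(3) unfolding ix_def by linarith
      moreover have "(g y - g x) * 3 / r - (g z - g x) * 3 / r = (g y - g z) * 3 / r"
        using r by (simp add: field_simps)
      ultimately have "\<bar>(g y - g z) * 3 / r\<bar> < 1" by (simp only:)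
      then have "\<bar>(g y - g z) * 3\<bar> < r" using r by simp
      then have "3 * \<bar>g z - g y\<bar> < r" by (simp add: abs_if split: if_splits)
      moreover have "y \<in> M" "z \<in> M" using y z by (auto simp: B_def)
      ultimately have "digit_dist z y \<le> r / 2" using g[of z y] by simp
      then show "y \<in> (\<Union>z\<in>C. mcball_of X z (r / 2))"
        using z \<open>y \<in> M\<close> \<open>z \<in> M\<close> by auto
    qed
    moreover have "B \<subseteq> M" by (auto simp: B_def)
    ultimately show "\<exists>C\<subseteq>mspace X. finite C \<and> card C \<le> 9 \<and> mcball_of X x r \<subseteq> (\<Union>c\<in>C. mcball_of X c (r / 2))"
      using fin unfolding B_def[symmetric] by (intro exI[of _ C]) (auto simp: C_def)
  qed simp
qed

section \<open>Failure of the three properties at every point\<close>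

text \<open>A neighbourhood contains cylinders of arbitrarily fine level \<open>n\<close> with
  \<open>c n = 1\<close> and \<open>K n\<close> large. The fan there lies in a ball of radius
  \<open>a n\<close>, while a ball of radius \<open>a n / 2\<close> sees only one digit at level
  \<open>n\<close>, so more than \<open>N\<close> balls are needed.\<close>

lemma S_doubling_X:
  assumes "\<And>N n0. \<exists>n\<ge>n0. c n = 1 \<and> N \<le> K n"
  shows "S doubling X = M"
proof -
  have "\<not> doubling (submetric X A)" if x: "x \<in> M" and nb: "neighbourhood X x A" for x A
  proof
    obtain n0 where n0: "\<And>y. y \<in> M \<Longrightarrow> agree n0 x y \<Longrightarrow> y \<in> A" and "x \<in> A" "A \<subseteq> M"
      using neighbourhood_X[OF nb x] by blast
    assume "doubling (submetric X A)"
    moreover have "mspace (submetric X A) = A" using \<open>A \<subseteq> M\<close> by auto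
    ultimately obtain N where N: "\<forall>x\<in>A. \<forall>r>0. \<exists>C\<subseteq>A. finite C \<and> card C \<le> N \<and>
        mcball_of (submetric X A) x r \<subseteq> (\<Union>c\<in>C. mcball_of (submetric X A) c (r / 2))"
      unfolding doubling_def by metis
    obtain n where n: "n \<ge> n0" "c n = 1" "N \<le> K n" using assms by blast
    obtain C where C: "finite C" "card C \<le> N"
      "mcball_of (submetric X A) x (a n) \<subseteq> (\<Union>c\<in>C. mcball_of (submetric X A) c (a n / 2))"
      using N \<open>x \<in> A\<close> a_pos[of n] by metis
    obtain y where y: "\<And>j. j \<le> K n \<Longrightarrow> y j \<in> M \<and> agree n x (y j) \<and> D n (y j) = j"
      using digit_fan[OF x] by metis
    have "{..K n} \<subseteq> D n ` C"
    proof
      fix j assume "j \<in> {..K n}"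
      then have j: "y j \<in> M" "agree n x (y j)" "D n (y j) = j" using y by auto
      have "y j \<in> mcball_of (submetric X A) x (a n)"
        using j n0 agree_mono[OF j(2) n(1)] \<open>x \<in> A\<close> x digit_dist_le[OF j(2)] n(2) by simp
      then obtain z where z: "z \<in> C" "digit_dist z (y j) \<le> a n / 2" using C(3) by auto
      then have "digit_dist z (y j) < a n" using a_pos[of n] by simp
      then have "D n z = j" using agree_if_dist_less j(3) agree_Suc by metis
      then show "j \<in> D n ` C" using z(1) by blast
    qed
    then have "card {..K n} \<le> card C" using C(1) surj_card_le by blast
    then show False using C(2) n(3) by simp
  qed
  then show ?thesis by (auto simp: S_def)
qed

text \<open>The fan points with digits \<open>0\<close> to \<open>c n\<close> form a chain with
  steps \<open>a n\<close> whose ends are \<open>a n * c n\<close> apart, a ratio of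
  \<open>1 / c n\<close>.\<close>

lemma S_uniformly_disconnected_X:
  assumes "\<And>N n0. \<exists>n\<ge>n0. N \<le> c n"
  shows "S uniformly_disconnected X = M"
proof -
  have "\<not> uniformly_disconnected (submetric X A)" if x: "x \<in> M" and nb: "neighbourhood X x A" for x A
  proof
    obtain n0 where n0: "\<And>y. y \<in> M \<Longrightarrow> agree n0 x y \<Longrightarrow> y \<in> A" and "x \<in> A" "A \<subseteq> M"
      using neighbourhood_X[OF nb x] by blast
    assume "uniformly_disconnected (submetric X A)"
    then obtain \<delta> where \<delta>: "0 < \<delta>" and const: "\<And>N z i j. delta_chain (submetric X A) \<delta> N z \<Longrightarrow>
        i \<in> {0..N} \<Longrightarrow> j \<in> {0..N} \<Longrightarrow> z i = z j"
      unfolding uniformly_disconnected_def by metis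
    obtain N where "1 / \<delta> < real N" using reals_Archimedean2 by blast
    moreover obtain n where n: "n \<ge> n0" "N \<le> c n" using assms by blast
    ultimately have "1 / \<delta> \<le> real (c n)" by linarith
    then have dc: "1 \<le> \<delta> * c n" using \<delta> by (simp add: field_simps)
    obtain y where y: "\<And>j. j \<le> K n \<Longrightarrow> y j \<in> M \<and> agree n x (y j) \<and> D n (y j) = j"
      using digit_fan[OF x] by metis
    have dist: "digit_dist (y i) (y j) = a n * min \<bar>real i - real j\<bar> (c n)"
      if "i \<le> K n" "j \<le> K n" "i \<noteq> j" for i j
    proof -
      have "agree n (y i) (y j)" using y that agree_sym agree_trans by meson
      then show ?thesis using digit_dist_first_diff[of n "y i" "y j"] y that by simp
    qed
    have "delta_chain (submetric X A) \<delta> (c n) y"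
      unfolding delta_chain_def
    proof (intro conjI ballI)
      show "y ` {0..c n} \<subseteq> mspace (submetric X A)"
        using y c_le_K[of n] n0 agree_mono[OF _ n(1)] by auto
      fix i assume i: "i \<in> {1..c n}"
      have "digit_dist (y (i - 1)) (y i) \<le> a n"
        using dist[of "i - 1" i] i c_le_K[of n] a_pos[of n] by (auto simp: of_nat_diff)
      also have "\<dots> \<le> a n * (\<delta> * c n)" using mult_left_mono[OF dc] a_pos[of n] by simp
      also have "\<dots> = \<delta> * digit_dist (y 0) (y (c n))"
        using dist[of 0 "c n"] c_le_K[of n] c_ge_1[of n] by simp
      finally show "mdist (submetric X A) (y (i - 1)) (y i) \<le> \<delta> * mdist (submetric X A) (y 0) (y (c n))"
        by simp
    qed
    then have "y 0 = y (c n)" using const by simp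
    then show False using y[of 0] y[of "c n"] c_le_K[of n] c_ge_1[of n] by simp
  qed
  then show ?thesis by (auto simp: S_def)
qed

text \<open>No distance lies strictly between \<open>a (Suc n) * c (Suc n)\<close> and
  \<open>a n\<close>. When this gap is wide, the annulus of outer radius \<open>a n / 2\<close>
  around any point of the neighbourhood's cylinder is empty.\<close>

lemma S_uniformly_perfect_X:
  assumes "\<And>\<rho> n0. 0 < \<rho> \<Longrightarrow> \<exists>n\<ge>n0. a (Suc n) * c (Suc n) < \<rho> * a n"
  shows "S uniformly_perfect X = M"
proof -
  have "\<not> uniformly_perfect (submetric X A)" if x: "x \<in> M" and nb: "neighbourhood X x A" for x A
  proof
    obtain n0 where n0: "\<And>y. y \<in> M \<Longrightarrow> agree n0 x y \<Longrightarrow> y \<in> A" and "x \<in> A" "A \<subseteq> M"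
      using neighbourhood_X[OF nb x] by blast
    assume "uniformly_perfect (submetric X A)"
    then obtain \<rho> where \<rho>: "0 < \<rho>" and ne: "\<And>x r. x \<in> mspace (submetric X A) \<Longrightarrow>
        0 < r \<and> ereal r < mdiam (submetric X A) \<Longrightarrow>
        mcball_of (submetric X A) x r - mball_of (submetric X A) x (\<rho> * r) \<noteq> {}"
      unfolding uniformly_perfect_def by metis
    obtain n where n: "n \<ge> n0" "a (Suc n) * c (Suc n) < \<rho> / 2 * a n"
      using assms[of "\<rho> / 2" n0] \<rho> by auto
    \<comment> \<open>A point with another digit at level \<open>n\<close> ensures that
      \<open>a n / 2\<close> is below the diameter of \<open>A\<close>.\<close>
    define j where "j = (if D n x = 0 then 1 else 0 :: nat)"
    have "j \<le> K n" "j \<noteq> D n x" using K_pos[of n] by (auto simp: j_def)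
    then obtain y where y: "y \<in> M" "agree n x y" "D n y \<noteq> D n x"
      using digit_fan[OF x] by metis
    have "y \<in> A" by (rule n0[OF y(1) agree_mono[OF y(2) n(1)]])
    have "a n \<le> digit_dist x y" using y by (intro digit_dist_ge) (simp add: agree_Suc)
    then have "ereal (a n / 2) < ereal (digit_dist x y)" using a_pos[of n] by simp
    also have "\<dots> \<le> mdiam (submetric X A)"
      unfolding mdiam_def using \<open>x \<in> A\<close> \<open>y \<in> A\<close> x y(1)
      by (intro SUP_upper2[where i = "(x, y)"]) auto
    finally have "mcball_of (submetric X A) x (a n / 2) - mball_of (submetric X A) x (\<rho> * (a n / 2)) \<noteq> {}"
      using a_pos[of n] x \<open>x \<in> A\<close> by (intro ne) auto
    then obtain z where "z \<in> mcball_of (submetric X A) x (a n / 2)"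
      "z \<notin> mball_of (submetric X A) x (\<rho> * (a n / 2))"
      by blast
    then have z: "digit_dist x z \<le> a n / 2" "\<rho> * (a n / 2) \<le> digit_dist x z" by simp_all
    have "digit_dist x z < a n" using z(1) a_pos[of n] by simp
    then have "digit_dist x z \<le> a (Suc n) * c (Suc n)" by (intro digit_dist_le agree_if_dist_less)
    then show False using z(2) n(2) by simp
  qed
  then show ?thesis by (auto simp: S_def)
qed

text \<open>The whole space is a neighbourhood of each of its points, so failure at every point also
  settles the type.\<close>

lemma not_if_S_eq:
  assumes "S P X = M"
  shows "\<not> P X"
proof -
  obtain x where "x \<in> S P X" using assms M_nonempty by blast
  moreover from this have "neighbourhood X x M"
    unfolding neighbourhood_def using openin_topspace[of "mtopology_of X"] assms by auto
  ultimately have "\<not> P (submetric X M)" by (simp add: S_def)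
  then show ?thesis using submetric_mspace[of X] by simp
qed

end

section \<open>Self-similarity of the middle-third Cantor set\<close>

lemma cantor_step_subset: "cantor_step n \<subseteq> {0..1}"
  by (induction n) auto

lemma cantor_set_subset: "p \<in> cantor_set \<Longrightarrow> 0 \<le> p \<and> p \<le> 1"
  using cantor_step_subset[of 0] unfolding cantor_set_def by (metis INT_E UNIV_I atLeastAtMost_iff subsetD)

lemma cantor_set_iff: "p \<in> cantor_set \<longleftrightarrow> (\<forall>n. p \<in> cantor_step n)"
  by (auto simp: cantor_set_def)

text \<open>The threshold \<open>1/2\<close> lies in the removed middle third, so it tells the left
  copy from the right one.\<close>

lemma cantor_set_step_left:
  assumes "p \<in> cantor_set" "p < 1/2"
  shows "3 * p \<in> cantor_set"
  unfolding cantor_set_iff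
proof
  fix n
  have "p \<in> cantor_step (Suc n)" using assms(1) cantor_set_iff by blast
  then show "3 * p \<in> cantor_step n" using assms(2) cantor_step_subset[of n] by force
qed

lemma cantor_set_step_right:
  assumes "p \<in> cantor_set" "\<not> p < 1/2"
  shows "3 * p - 2 \<in> cantor_set"
  unfolding cantor_set_iff
proof
  fix n
  have "p \<in> cantor_step (Suc n)" using assms(1) cantor_set_iff by blast
  moreover have "p \<noteq> x / 3" if "x \<in> cantor_step n" for x
    using assms(2) cantor_step_subset[of n] that by force
  ultimately obtain x where "x \<in> cantor_step n" "p = (x + 2) / 3"
    unfolding cantor_step.simps by blast
  moreover from this have "3 * p - 2 = x" by simp
  ultimately show "3 * p - 2 \<in> cantor_step n" by simp
qed

lemma cantor_set_left:
  assumes "p \<in> cantor_set"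
  shows "p / 3 \<in> cantor_set"
  unfolding cantor_set_iff
proof
  show "p / 3 \<in> cantor_step n" for n
    using assms cantor_set_subset[OF assms] by (cases n) (auto simp: cantor_set_iff)
qed

lemma cantor_set_right:
  assumes "p \<in> cantor_set"
  shows "(p + 2) / 3 \<in> cantor_set"
  unfolding cantor_set_iff
proof
  show "(p + 2) / 3 \<in> cantor_step n" for n
    using assms cantor_set_subset[OF assms] by (cases n) (auto simp: cantor_set_iff)
qed

lemma zero_in_cantor_set: "0 \<in> cantor_set"
  unfolding cantor_set_iff
proof
  show "0 \<in> cantor_step n" for n by (induction n) auto
qed

text \<open>The leading ternary digits \<open>2\<close> of a point are counted, but at most \<^term>\<open>k\<close> of them.
  This is the complete prefix code \<open>0, 20, 220, \<dots>\<close> with \<^term>\<open>Suc k\<close> code words, and it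
  identifies the Cantor set with \<^term>\<open>Suc k\<close> copies of itself; \<^term>\<open>rest\<close> is the
  point left after the code word has been removed.\<close>

fun code :: "nat \<Rightarrow> real \<Rightarrow> nat" where
  "code 0 p = 0"
| "code (Suc k) p = (if p < 1/2 then 0 else Suc (code k (3 * p - 2)))"

fun rest :: "nat \<Rightarrow> real \<Rightarrow> real" where
  "rest 0 p = p"
| "rest (Suc k) p = (if p < 1/2 then 3 * p else rest k (3 * p - 2))"

lemma code_le: "code k p \<le> k"
  by (induction k p rule: code.induct) auto

lemma rest_in_cantor_set: "p \<in> cantor_set \<Longrightarrow> rest k p \<in> cantor_set"
proof (induction k p rule: rest.induct)
  case (2 k p)
  then show ?case using cantor_set_step_left[of p] cantor_set_step_right[of p] by auto
qed simp

text \<open>Code words are prepended backwards: \<open>q / 3\<close> prepends the ternary digit 0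
  and \<open>(p + 2) / 3\<close> the ternary digit 2.\<close>

lemma code_surj:
  assumes "q \<in> cantor_set" "j \<le> k"
  shows "\<exists>p\<in>cantor_set. code k p = j \<and> rest k p = q"
  using assms(2)
proof (induction k arbitrary: j)
  case 0
  then show ?case using assms(1) by auto
next
  case (Suc k)
  show ?case
  proof (cases j)
    case 0
    then show ?thesis
      using cantor_set_left[OF assms(1)] cantor_set_subset[OF assms(1)]
      by (intro bexI[of _ "q / 3"]) auto
  next
    case (Suc i)
    then obtain p where p: "p \<in> cantor_set" "code k p = i" "rest k p = q"
      using Suc.IH[of i] Suc.prems by auto
    have "3 * ((p + 2) / 3) - 2 = p" "\<not> (p + 2) / 3 < 1/2"
      using cantor_set_subset[OF p(1)] by (simp_all add: field_simps)
    then show ?thesis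
      using cantor_set_right[OF p(1)] p Suc
      by (intro bexI[of _ "(p + 2) / 3"]) (simp_all del: times_divide_eq_right)
  qed
qed

text \<open>Each ternary digit removed from both points triples their distance. A code word may be
  empty (\<open>k = 0\<close>), so only factor 1 is guaranteed here; this handles what follows the
  first ternary digit in \<open>dist_rest_ge_3\<close>.\<close>

lemma dist_rest_ge: "code k p = code k q \<Longrightarrow> \<bar>p - q\<bar> \<le> \<bar>rest k p - rest k q\<bar>"
proof (induction k arbitrary: p q)
  case (Suc k)
  show ?case
  proof (cases "p < 1/2")
    case True
    then show ?thesis using Suc.prems by (auto split: if_splits)
  next
    case False
    then have "\<bar>(3 * p - 2) - (3 * q - 2)\<bar> \<le> \<bar>rest (Suc k) p - rest (Suc k) q\<bar>"
      using Suc.prems Suc.IH[of "3 * p - 2" "3 * q - 2"] by (auto split: if_splits)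
    then show ?thesis by linarith
  qed
qed simp

lemma dist_rest_ge_3:
  assumes "1 \<le> k" "code k p = code k q"
  shows "3 * \<bar>p - q\<bar> \<le> \<bar>rest k p - rest k q\<bar>"
proof -
  obtain l where l: "k = Suc l" using assms(1) by (cases k) auto
  show ?thesis
  proof (cases "p < 1/2")
    case True
    then have "rest k p = 3 * p" "rest k q = 3 * q" using assms(2) l by (auto split: if_splits)
    then show ?thesis by (simp add: abs_if)
  next
    case False
    then show ?thesis
      using assms(2) l dist_rest_ge[of l "3 * p - 2" "3 * q - 2"] by (auto simp: abs_if split: if_splits)
  qed
qed

lemma cantor_set_gap:
  assumes "p \<in> cantor_set" "q \<in> cantor_set" "\<bar>p - q\<bar> < 1/3"
  shows "p < 1/2 \<longleftrightarrow> q < 1/2"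
proof -
  have gap: "x \<le> 1/3 \<or> 2/3 \<le> x" if "x \<in> cantor_set" for x
    using cantor_set_step_left[OF that] cantor_set_step_right[OF that]
      cantor_set_subset[of "3 * x"] cantor_set_subset[of "3 * x - 2"] by linarith
  show ?thesis using gap[OF assms(1)] gap[OF assms(2)] assms(3) by linarith
qed

text \<open>At most \<open>k\<close> ternary digits are removed, each tripling the distance. Before
  each removal the distance is still below \<open>1/3\<close>, the width of the gap, so both points
  lie on the same side.\<close>

lemma code_locally_constant:
  assumes "p \<in> cantor_set" "q \<in> cantor_set" "\<bar>p - q\<bar> < 1 / 3 ^ k"
  shows "code k p = code k q \<and> \<bar>rest k p - rest k q\<bar> \<le> 3 ^ k * \<bar>p - q\<bar>"
  using assms
proof (induction k arbitrary: p q)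
  case (Suc k)
  have "(3::real) * 1 \<le> 3 * 3 ^ k" by (intro mult_left_mono) auto
  then have "1 / (3 * 3 ^ k) \<le> 1 / (3::real)" by (intro divide_left_mono) auto
  then have iff: "p < 1/2 \<longleftrightarrow> q < 1/2"
    using Suc.prems by (intro cantor_set_gap less_le_trans[OF Suc.prems(3)]) auto
  show ?case
  proof (cases "p < 1/2")
    case True
    have "3 * \<bar>p - q\<bar> \<le> (3 * 3 ^ k) * \<bar>p - q\<bar>" by (intro mult_right_mono) auto
    then show ?thesis using True iff by simp
  next
    case False
    have eq: "\<bar>(3 * p - 2) - (3 * q - 2)\<bar> = 3 * \<bar>p - q\<bar>" by (simp add: abs_if)
    have "3 * \<bar>p - q\<bar> < 1 / 3 ^ k" using Suc.prems(3) by (simp add: field_simps)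
    then have "code k (3 * p - 2) = code k (3 * q - 2) \<and>
        \<bar>rest k (3 * p - 2) - rest k (3 * q - 2)\<bar> \<le> 3 ^ k * (3 * \<bar>p - q\<bar>)"
      using Suc.IH[of "3 * p - 2" "3 * q - 2"] False iff Suc.prems cantor_set_step_right eq
      by metis
    then show ?thesis using False iff by simp
  qed
qed simp

section \<open>Mixed-radix digit sequences on the Cantor set\<close>

text \<open>The ternary expansion is parsed into successive code words, the one at position
  \<open>n\<close> coming from the code with \<open>K n + 1\<close> words; \<open>shift\<close>
  keeps the unparsed remainder.\<close>

primrec shift :: "(nat \<Rightarrow> nat) \<Rightarrow> nat \<Rightarrow> real \<Rightarrow> real" where
  "shift K 0 p = p"
| "shift K (Suc n) p = rest (K n) (shift K n p)"

definition digit :: "(nat \<Rightarrow> nat) \<Rightarrow> nat \<Rightarrow> real \<Rightarrow> nat" where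
  "digit K n p = code (K n) (shift K n p)"

lemma shift_in_cantor_set: "p \<in> cantor_set \<Longrightarrow> shift K n p \<in> cantor_set"
  by (induction n) (auto intro: rest_in_cantor_set)

text \<open>Digits are prepended from the last to the first, so the induction must allow an
  arbitrary remainder \<open>q\<close>.\<close>

lemma shift_surj:
  assumes "p \<in> cantor_set" "q \<in> cantor_set"
  shows "\<exists>p'\<in>cantor_set. (\<forall>m<n. digit K m p = digit K m p') \<and> shift K n p' = q"
  using assms(2)
proof (induction n arbitrary: q)
  case 0
  then show ?case by auto
next
  case (Suc n)
  obtain r where r: "r \<in> cantor_set" "code (K n) r = digit K n p" "rest (K n) r = q"
    using code_surj[OF Suc.prems code_le] unfolding digit_def by metis
  obtain p' where "p' \<in> cantor_set" "\<forall>m<n. digit K m p = digit K m p'" "shift K n p' = r"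
    using Suc.IH[OF r(1)] by blast
  then show ?case using r by (intro bexI[of _ p']) (auto simp: digit_def less_Suc_eq)
qed

lemma digit_surj:
  assumes "p \<in> cantor_set" "j \<le> K n"
  shows "\<exists>q\<in>cantor_set. (\<forall>m<n. digit K m p = digit K m q) \<and> digit K n q = j"
  \<comment> \<open>The remainder after digit \<open>n\<close> is arbitrary; \<open>0\<close> is
    chosen.\<close>
  using code_surj[OF zero_in_cantor_set assms(2)] shift_surj[OF assms(1)]
  unfolding digit_def by metis

text \<open>Each common digit removed at least triples the distance, yet the shifted points still
  lie in the unit interval.\<close>

lemma dist_le_if_digits_eq:
  assumes "p \<in> cantor_set" "q \<in> cantor_set" "\<And>n. 1 \<le> K n" "\<forall>m<n. digit K m p = digit K m q"
  shows "\<bar>p - q\<bar> \<le> (1 / 3) ^ n"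
proof -
  have "\<bar>p - q\<bar> * 3 ^ n \<le> \<bar>shift K n p - shift K n q\<bar>"
    using assms(4)
  proof (induction n)
    case (Suc n)
    then have "3 * \<bar>shift K n p - shift K n q\<bar> \<le> \<bar>shift K (Suc n) p - shift K (Suc n) q\<bar>"
      using dist_rest_ge_3[OF assms(3)] by (simp add: digit_def)
    then show ?case using Suc by simp
  qed simp
  also have "\<dots> \<le> 1"
    using cantor_set_subset[OF shift_in_cantor_set[OF assms(1), of K n]]
      cantor_set_subset[OF shift_in_cantor_set[OF assms(2), of K n]] by linarith
  finally show ?thesis by (simp add: field_simps power_one_over)
qed

text \<open>The induction also carries a Lipschitz bound for \<open>shift K n\<close> at close
  points, which passes closeness on to the next digit.\<close>

lemma digits_locally_constant:
  "\<exists>\<delta>>0. \<forall>p\<in>cantor_set. \<forall>q\<in>cantor_set. \<bar>p - q\<bar> < \<delta> \<longrightarrow> (\<forall>m<n. digit K m p = digit K m q)"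
proof -
  have "\<exists>\<delta>>0. \<exists>L>0. \<forall>p\<in>cantor_set. \<forall>q\<in>cantor_set. \<bar>p - q\<bar> < \<delta> \<longrightarrow>
    (\<forall>m<n. digit K m p = digit K m q) \<and> \<bar>shift K n p - shift K n q\<bar> \<le> L * \<bar>p - q\<bar>"
  proof (induction n)
    case 0
    show ?case by (intro exI[of _ "1::real"] conjI) auto
  next
    case (Suc n)
    then obtain \<delta> L :: real where \<delta>: "\<delta> > 0" "L > 0" and IH: "\<And>p q. p \<in> cantor_set \<Longrightarrow> q \<in> cantor_set \<Longrightarrow>
      \<bar>p - q\<bar> < \<delta> \<Longrightarrow> (\<forall>m<n. digit K m p = digit K m q) \<and> \<bar>shift K n p - shift K n q\<bar> \<le> L * \<bar>p - q\<bar>"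
      by metis
    \<comment> \<open>The second term brings the shifted points within the threshold
      \<open>1 / 3 ^ K n\<close> of \<open>code_locally_constant\<close>.\<close>
    define \<epsilon> where "\<epsilon> = min \<delta> (1 / 3 ^ K n / L)"
    have "(\<forall>m<Suc n. digit K m p = digit K m q) \<and>
        \<bar>shift K (Suc n) p - shift K (Suc n) q\<bar> \<le> (3 ^ K n * L) * \<bar>p - q\<bar>"
      if pq: "p \<in> cantor_set" "q \<in> cantor_set" "\<bar>p - q\<bar> < \<epsilon>" for p q
    proof -
      have l: "\<bar>shift K n p - shift K n q\<bar> \<le> L * \<bar>p - q\<bar>"
        and d: "\<forall>m<n. digit K m p = digit K m q"
        using IH pq unfolding \<epsilon>_def by auto
      have "\<bar>p - q\<bar> < 1 / 3 ^ K n / L" using pq(3) by (simp add: \<epsilon>_def)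
      then have "L * \<bar>p - q\<bar> < 1 / 3 ^ K n" using \<delta>(2) by (simp add: field_simps)
      then have "code (K n) (shift K n p) = code (K n) (shift K n q) \<and>
          \<bar>shift K (Suc n) p - shift K (Suc n) q\<bar> \<le> 3 ^ K n * \<bar>shift K n p - shift K n q\<bar>"
        using code_locally_constant[of "shift K n p" "shift K n q" "K n"] l pq shift_in_cantor_set
        by simp
      moreover have "3 ^ K n * \<bar>shift K n p - shift K n q\<bar> \<le> 3 ^ K n * (L * \<bar>p - q\<bar>)"
        using l by (intro mult_left_mono) auto
      ultimately have "code (K n) (shift K n p) = code (K n) (shift K n q)"
        "\<bar>shift K (Suc n) p - shift K (Suc n) q\<bar> \<le> 3 ^ K n * L * \<bar>p - q\<bar>"
        unfolding mult.assoc by linarith+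
      then show ?thesis using d by (auto simp: digit_def less_Suc_eq)
    qed
    moreover have "\<epsilon> > 0" "3 ^ K n * L > 0" using \<delta> by (auto simp: \<epsilon>_def)
    ultimately show ?case by blast
  qed
  then show ?thesis by blast
qed

section \<open>Digit metrics on the Cantor set itself\<close>

locale cantor_digit_space =
  fixes K c :: "nat \<Rightarrow> nat" and a :: "nat \<Rightarrow> real"
  assumes c_bounds: "1 \<le> c n" "c n \<le> K n"
    and scale_pos: "0 < a n"
    and scale_Suc: "4 * (a (Suc n) * c (Suc n)) \<le> a n"
begin

lemma K_ge_1: "1 \<le> K n"
  using c_bounds[of n] by linarith

sublocale digit_space cantor_set "digit K" K c a
proof
  show "cantor_set \<noteq> {}" using zero_in_cantor_set by blast
  show "digit K n p \<le> K n" for n p by (simp add: digit_def code_le)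
  show "\<exists>q\<in>cantor_set. (\<forall>m<n. digit K m p = digit K m q) \<and> digit K n q = j"
    if "p \<in> cantor_set" "j \<le> K n" for p j n using digit_surj[where K = K] that by blast
  fix p q assume pq: "p \<in> cantor_set" "q \<in> cantor_set" and eq: "\<And>n. digit K n p = digit K n q"
  have "\<bar>p - q\<bar> \<le> (1 / 3) ^ n" for n
    using dist_le_if_digits_eq[where K = K, OF pq K_ge_1] eq by blast
  moreover have "(\<lambda>n. (1 / 3) ^ n) \<longlonglongrightarrow> (0::real)" by (intro LIMSEQ_power_zero) simp
  ultimately have "\<bar>p - q\<bar> \<le> 0" by (intro LIMSEQ_le_const) auto
  then show "p = q" by simp
qed (use c_bounds scale_pos scale_Suc in auto)

text \<open>The identity is the homeomorphism: \<open>digits_locally_constant\<close> makes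
  cylinders open in the usual topology, and \<open>dist_le_if_digits_eq\<close> makes them shrink to
  points.\<close>

lemma cantor_metric_space_X: "cantor_metric_space X"
proof -
  have "(\<exists>n. \<forall>y\<in>cantor_set. agree n x y \<longrightarrow> y \<in> U) \<longleftrightarrow> (\<exists>e>0. \<forall>y\<in>cantor_set. dist y x < e \<longrightarrow> y \<in> U)"
    if "x \<in> cantor_set" for x U
  proof
    assume "\<exists>n. \<forall>y\<in>cantor_set. agree n x y \<longrightarrow> y \<in> U"
    then obtain n where n: "\<forall>y\<in>cantor_set. agree n x y \<longrightarrow> y \<in> U" by blast
    obtain \<delta> where "\<delta> > 0" "\<forall>p\<in>cantor_set. \<forall>q\<in>cantor_set. \<bar>p - q\<bar> < \<delta> \<longrightarrow> (\<forall>m<n. digit K m p = digit K m q)"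
      using digits_locally_constant[of n K] by blast
    then show "\<exists>e>0. \<forall>y\<in>cantor_set. dist y x < e \<longrightarrow> y \<in> U"
      using n that unfolding agree_def by (metis dist_commute dist_real_def)
  next
    assume "\<exists>e>0. \<forall>y\<in>cantor_set. dist y x < e \<longrightarrow> y \<in> U"
    then obtain e where e: "e > 0" "\<forall>y\<in>cantor_set. dist y x < e \<longrightarrow> y \<in> U" by blast
    obtain n where "(1 / 3) ^ n < e" using real_arch_pow_inv[OF e(1), of "1/3"] by auto
    then have "y \<in> U" if "y \<in> cantor_set" "agree n x y" for y
      using dist_le_if_digits_eq[where K = K, OF \<open>x \<in> cantor_set\<close> that(1) K_ge_1, of n] that e(2)
      by (auto simp: agree_def dist_real_def abs_minus_commute)
    then show "\<exists>n. \<forall>y\<in>cantor_set. agree n x y \<longrightarrow> y \<in> U" by blast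
  qed
  then have "openin (mtopology_of X) U \<longleftrightarrow> openin (top_of_set cantor_set) U" for U
    unfolding openin_X openin_euclidean_subtopology_iff by blast
  then have "mtopology_of X = top_of_set cantor_set" by (simp add: topology_eq)
  then show ?thesis by (simp add: cantor_metric_space_def homeomorphic_space_refl)
qed

end

section \<open>Choice of parameters for the seven exotic types\<close>

text \<open>Solves \<open>s n * (a (Suc n) * c (Suc n)) = a n\<close>, so \<open>s n\<close> is
  exactly the gap ratio between levels \<open>n\<close> and \<open>Suc n\<close>.\<close>

primrec scale :: "(nat \<Rightarrow> nat) \<Rightarrow> (nat \<Rightarrow> nat) \<Rightarrow> nat \<Rightarrow> real" where
  "scale c s 0 = 1"
| "scale c s (Suc n) = scale c s n / (s n * c (Suc n))"

theorem theorem1p2: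
  fixes u v w :: nat
  assumes "u \<in> {0, 1}" and "v \<in> {0, 1}" and "w \<in> {0, 1}"
    and "(u, v, w) \<noteq> (1, 1, 1)"
  shows "\<exists>X :: real metric. cantor_metric_space X \<and> totally_exotic_type X (u, v, w)"
proof -
  \<comment> \<open>D wants \<open>c = K\<close> and UD wants \<open>c = 1\<close>, so both together
    force binary digits; otherwise \<open>K\<close> is unbounded.\<close>
  define K where "K n = (if u = 1 \<and> v = 1 then 1 else Suc n)" for n
  \<comment> \<open>If both D and UD must fail, even levels supply equidistant points and odd levels
    supply long chains.\<close>
  define c where "c n = (if v = 1 \<or> (u = 0 \<and> even n) then 1 else K n)" for n
  \<comment> \<open>Ratio 4 gives UP, an unbounded ratio destroys it; both are at least 4, as level
    separation requires.\<close>
  define s where "s n = (if w = 1 then 4 else n + 4)" for n :: nat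
  define a where "a = scale c s"
  have c: "1 \<le> c n" "c n \<le> K n" for n by (auto simp: c_def K_def)
  have s: "4 \<le> s n" for n by (auto simp: s_def)
  have a_pos: "0 < a n" for n
    unfolding a_def
  proof (induction n)
    case (Suc n)
    have "0 < c (Suc n)" "0 < s n" using c(1)[of "Suc n"] s[of n] by auto
    then show ?case using Suc by simp
  qed simp
  have scale_eq: "s n * (a (Suc n) * c (Suc n)) = a n" for n
    using c(1)[of "Suc n"] s[of n] by (simp add: a_def)
  interpret cantor_digit_space K c a
  proof
    show "4 * (a (Suc n) * c (Suc n)) \<le> a n" for n
    proof -
      have "4 * (a (Suc n) * c (Suc n)) \<le> s n * (a (Suc n) * c (Suc n))"
        using s[of n] a_pos[of "Suc n"] by (intro mult_right_mono) auto
      then show ?thesis by (simp add: scale_eq)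
    qed
  qed (use c a_pos in auto)
  have D: "if u = 1 then doubling X else S doubling X = cantor_set"
  proof (cases "u = 1")
    case True
    then have "c n = K n" for n by (auto simp: c_def K_def)
    then show ?thesis using True doubling_X by simp
  next
    case False
    have "\<exists>n\<ge>n0. c n = 1 \<and> N \<le> K n" for N n0
      \<comment> \<open>An even index, so that \<open>c n = 1\<close> also when
        \<open>v = 0\<close>.\<close>
      using False assms(1) by (intro exI[of _ "2 * (N + n0)"]) (auto simp: c_def K_def)
    then show ?thesis using False S_doubling_X by simp
  qed
  have UD: "if v = 1 then uniformly_disconnected X else S uniformly_disconnected X = cantor_set"
  proof (cases "v = 1")
    case True
    then show ?thesis using uniformly_disconnected_X by (simp add: c_def)
  next
    case False
    have "\<exists>n\<ge>n0. N \<le> c n" for N n0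
      \<comment> \<open>An odd index, so that \<open>c n = K n\<close> also when
        \<open>u = 0\<close>.\<close>
      using False by (intro exI[of _ "2 * (N + n0) + 1"]) (auto simp: c_def K_def)
    then show ?thesis using False S_uniformly_disconnected_X by simp
  qed
  have UP: "if w = 1 then uniformly_perfect X else S uniformly_perfect X = cantor_set"
  proof (cases "w = 1")
    case True
    have "a n \<le> 4 * (a (Suc n) * c (Suc n))" for n
      using scale_eq[of n] True by (simp add: s_def)
    then show ?thesis using True uniformly_perfect_X by simp
  next
    case False
    have "\<exists>n\<ge>n0. a (Suc n) * c (Suc n) < \<rho> * a n" if "0 < \<rho>" for \<rho> n0
    proof -
      obtain N :: nat where N: "1 / \<rho> < N" using reals_Archimedean2 by blast
      define n where "n = N + n0"
      have "1 / \<rho> < s n" using N False by (simp add: n_def s_def)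
      then have "1 < \<rho> * s n" using that by (simp add: field_simps)
      moreover have "0 < a (Suc n) * c (Suc n)" using a_pos[of "Suc n"] c(1)[of "Suc n"] by simp
      ultimately have "1 * (a (Suc n) * c (Suc n)) < (\<rho> * s n) * (a (Suc n) * c (Suc n))"
        by (rule mult_strict_right_mono)
      also have "\<dots> = \<rho> * a n" using scale_eq[of n] by simp
      finally show ?thesis by (intro exI[of _ n]) (simp add: n_def)
    qed
    then show ?thesis using False S_uniformly_perfect_X by simp
  qed
  have "totally_exotic_type X (u, v, w)"
    using D UD UP assms not_if_S_eq
    by (auto simp: totally_exotic_type_def exotic_def has_type_def T_def split: if_splits)
  then show ?thesis using cantor_metric_space_X by blast
qed

end
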